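(* Let $G$ be a finite simple graph, let $G_E$ be its reduced graph with respect to the relation $\sim$, and let $G_{E'}$ be the analogous quotient graph with respect to the relation $\sim'$. Then $\mathrm{box}(G_E)=\mathrm{box}(G_{E'})$.
   Context: Let $G=(V,E)$ be a finite simple graph and let $N(v)$ denote the set of neighbours of $v$. For $u,v\in V$ write $u\sim v$ if $N(u)=N(v)$, and $u\sim' v$ if $N(u)\setminus\{u,v\}=N(v)\setminus\{u,v\}$. Both are equivalence relations on $V$; denote the class of $v$ by $[v]$ and $[v]'$, respectively. The reduced graph $G_E$ has vertex set $\{[v]\colon v\in V\}$ and edge set $\{\{[u],[v]\}\colon \{u,v\}\in E\}$. The graph $G_{E'}$ has vertex set $\{[v]'\colon v\in V\}$ and edge set $\{\{[u]',[v]'\}\colon [u]'\ne[v]' \text{ and } \{u,v\}\in E\}$. The boxicity $\mathrm{box}(H)$ of a finite simple graph $H$ is the minimum integer $d\ge 0$ such that there exist $d$ interval graphs $I_1,\dots,I_d$ on $V(H)$ with $E(H)=\bigcap_{j=1}^d E(I_j)$; the empty intersection ($d=0$) is the set of all pairs of vertices, so $\mathrm{box}(H)=0$ iff $H$ is complete. *)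

theory Defs
  imports Complex_Main
begin

record 'a ugraph =
  verts :: "'a set"
  edges :: "'a set set"

definition all_pairs :: "'a set \<Rightarrow> 'a set set" where
  "all_pairs V = {{u, v} |u v. u \<in> V \<and> v \<in> V \<and> u \<noteq> v}"

definition fin_simple_graph :: "'a ugraph \<Rightarrow> bool" where
  "fin_simple_graph G \<longleftrightarrow> finite (verts G) \<and> edges G \<subseteq> all_pairs (verts G)"

definition nbrs :: "'a ugraph \<Rightarrow> 'a \<Rightarrow> 'a set" where
  "nbrs G v = {u \<in> verts G. {u, v} \<in> edges G}"

definition twin_rel :: "'a ugraph \<Rightarrow> ('a \<times> 'a) set" where
  "twin_rel G = {(u, v). u \<in> verts G \<and> v \<in> verts G \<and> nbrs G u = nbrs G v}"

definition twin_rel' :: "'a ugraph \<Rightarrow> ('a \<times> 'a) set" where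
  "twin_rel' G = {(u, v). u \<in> verts G \<and> v \<in> verts G \<and>
                          nbrs G u - {u, v} = nbrs G v - {u, v}}"

definition reduced_graph :: "'a ugraph \<Rightarrow> 'a set ugraph" where
  "reduced_graph G =
     \<lparr> verts = verts G // twin_rel G,
       edges = {{twin_rel G `` {u}, twin_rel G `` {v}} |u v. {u, v} \<in> edges G} \<rparr>"

definition reduced_graph' :: "'a ugraph \<Rightarrow> 'a set ugraph" where
  "reduced_graph' G =
     \<lparr> verts = verts G // twin_rel' G,
       edges = {{twin_rel' G `` {u}, twin_rel' G `` {v}} |u v.
                  twin_rel' G `` {u} \<noteq> twin_rel' G `` {v} \<and> {u, v} \<in> edges G} \<rparr>"

text \<open>Interval graphs are intersection graphs of nonempty closed real intervals.\<close>

definition interval_graph :: "'a ugraph \<Rightarrow> bool" where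
  "interval_graph G \<longleftrightarrow> fin_simple_graph G \<and>
     (\<exists>l r :: 'a \<Rightarrow> real.
        (\<forall>v \<in> verts G. l v \<le> r v) \<and>
        (\<forall>u \<in> verts G. \<forall>v \<in> verts G. u \<noteq> v \<longrightarrow>
           ({u, v} \<in> edges G \<longleftrightarrow> {l u..r u} \<inter> {l v..r v} \<noteq> {})))"

text \<open>
  Intersecting with all pairs only matters for \<open>d = 0\<close>, where \<open>\<Inter>\<close> over the empty
  index set would otherwise be the universal set.
\<close>

definition box_representable :: "'a ugraph \<Rightarrow> nat \<Rightarrow> bool" where
  "box_representable H d \<longleftrightarrow>
     (\<exists>I :: nat \<Rightarrow> 'a ugraph.
        (\<forall>j<d. interval_graph (I j) \<and> verts (I j) = verts H) \<and>
        edges H = all_pairs (verts H) \<inter> (\<Inter>j<d. edges (I j)))"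

definition boxicity :: "'a ugraph \<Rightarrow> nat" where
  "boxicity H = (LEAST d. box_representable H d)"

text \<open>
  The notions are well defined: both relations are equivalences, both quotients are finite
  simple graphs, and the minimum in \<open>boxicity\<close> is over a nonempty set.
\<close>

lemma equiv_twin_rel: "equiv (verts G) (twin_rel G)"
  by (rule equivI) (auto simp: twin_rel_def refl_on_def sym_def trans_def)

lemma mem_nbrs_commute: "u \<in> verts G \<Longrightarrow> v \<in> nbrs G u \<Longrightarrow> u \<in> nbrs G v"
  by (auto simp: nbrs_def insert_commute)

lemma equiv_twin_rel': "equiv (verts G) (twin_rel' G)"
proof (rule equivI)
  show "twin_rel' G \<subseteq> verts G \<times> verts G"
    by (auto simp: twin_rel'_def)
  show "refl_on (verts G) (twin_rel' G)"
    by (auto simp: twin_rel'_def refl_on_def)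
  show "sym (twin_rel' G)"
    by (auto simp: twin_rel'_def sym_def insert_commute)
  show "trans (twin_rel' G)"
  proof (rule transI)
    fix u v w assume uv: "(u, v) \<in> twin_rel' G" and vw: "(v, w) \<in> twin_rel' G"
    have V: "u \<in> verts G" "v \<in> verts G" "w \<in> verts G"
      using uv vw by (auto simp: twin_rel'_def)
    have 1: "x \<in> nbrs G u \<longleftrightarrow> x \<in> nbrs G v" if "x \<noteq> u" "x \<noteq> v" for x
      using uv that by (auto simp: twin_rel'_def)
    have 2: "x \<in> nbrs G v \<longleftrightarrow> x \<in> nbrs G w" if "x \<noteq> v" "x \<noteq> w" for x
      using vw that by (auto simp: twin_rel'_def)
    have c: "x \<in> nbrs G y \<longleftrightarrow> y \<in> nbrs G x" if "x \<in> verts G" "y \<in> verts G" for x y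
      using that mem_nbrs_commute by metis
    have "x \<in> nbrs G u \<longleftrightarrow> x \<in> nbrs G w" if "x \<noteq> u" "x \<noteq> w" for x
    proof (cases "x = v")
      case True
      then show ?thesis
        using that 1[of w] 2[of u] c V by metis
    next
      case False
      then show ?thesis using that 1 2 by blast
    qed
    then show "(u, w) \<in> twin_rel' G"
      using V by (auto simp: twin_rel'_def)
  qed
qed

lemma fin_simple_graph_edgeD:
  assumes "fin_simple_graph G" "{u, v} \<in> edges G"
  shows "u \<in> verts G" "v \<in> verts G" "u \<noteq> v"
proof -
  obtain a b where "{u, v} = {a, b}" "a \<in> verts G" "b \<in> verts G" "a \<noteq> b"
    using assms unfolding fin_simple_graph_def all_pairs_def by blast
  then show "u \<in> verts G" "v \<in> verts G" "u \<noteq> v"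
    by (auto simp: doubleton_eq_iff)
qed

lemma fin_simple_reduced_graph:
  assumes G: "fin_simple_graph G"
  shows "fin_simple_graph (reduced_graph G)"
proof -
  have "finite (verts G // twin_rel G)"
    using G by (simp add: quotient_def fin_simple_graph_def)
  moreover have "{twin_rel G `` {u}, twin_rel G `` {v}} \<in> all_pairs (verts G // twin_rel G)"
    if e: "{u, v} \<in> edges G" for u v
  proof -
    note V = fin_simple_graph_edgeD[OF G e]
    have "u \<in> nbrs G v" "u \<notin> nbrs G u"
      using V e fin_simple_graph_edgeD(3)[OF G, of u u] by (auto simp: nbrs_def)
    then have "(u, v) \<notin> twin_rel G" by (auto simp: twin_rel_def)
    then have "twin_rel G `` {u} \<noteq> twin_rel G `` {v}"
      using V eq_equiv_class_iff[OF equiv_twin_rel] by metis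
    then show ?thesis
      using V unfolding all_pairs_def by (blast intro: quotientI)
  qed
  ultimately show ?thesis
    by (auto simp: fin_simple_graph_def reduced_graph_def)
qed

lemma fin_simple_reduced_graph':
  assumes G: "fin_simple_graph G"
  shows "fin_simple_graph (reduced_graph' G)"
proof -
  have "finite (verts G // twin_rel' G)"
    using G by (simp add: quotient_def fin_simple_graph_def)
  moreover have "{twin_rel' G `` {u}, twin_rel' G `` {v}} \<in> all_pairs (verts G // twin_rel' G)"
    if "{u, v} \<in> edges G" "twin_rel' G `` {u} \<noteq> twin_rel' G `` {v}" for u v
    using that fin_simple_graph_edgeD[OF G that(1)]
    unfolding all_pairs_def by (blast intro: quotientI)
  ultimately show ?thesis
    by (auto simp: fin_simple_graph_def reduced_graph'_def)
qed

lemma interval_graph_minus_pair: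
  assumes "finite V" "e \<in> all_pairs V"
  shows "interval_graph \<lparr> verts = V, edges = all_pairs V - {e} \<rparr>"
proof -
  obtain a b where e: "e = {a, b}" "a \<noteq> b"
    using assms(2) by (auto simp: all_pairs_def)
  define l r :: "'a \<Rightarrow> real" where "l v = (if v = b then 1 else 0)"
    and "r v = (if v = a then 0 else 1)" for v
  have "{u, v} \<in> all_pairs V - {e} \<longleftrightarrow> {l u..r u} \<inter> {l v..r v} \<noteq> {}"
    if "u \<in> V" "v \<in> V" "u \<noteq> v" for u v
  proof -
    have "{u, v} \<in> all_pairs V" using that by (auto simp: all_pairs_def)
    moreover have "{l u..r u} \<inter> {l v..r v} \<noteq> {} \<longleftrightarrow> {u, v} \<noteq> e"
      using that e by (auto simp: l_def r_def doubleton_eq_iff)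
    ultimately show ?thesis by blast
  qed
  moreover have "l v \<le> r v" for v using e by (simp add: l_def r_def)
  ultimately have "\<exists>l r :: 'a \<Rightarrow> real. (\<forall>v \<in> V. l v \<le> r v) \<and>
      (\<forall>u \<in> V. \<forall>v \<in> V. u \<noteq> v \<longrightarrow>
        ({u, v} \<in> all_pairs V - {e} \<longleftrightarrow> {l u..r u} \<inter> {l v..r v} \<noteq> {}))"
    by (intro exI[of _ l] exI[of _ r] conjI ballI impI)
  then show ?thesis
    using assms(1) unfolding interval_graph_def fin_simple_graph_def ugraph.simps
    by (intro conjI Diff_subset)
qed

lemma box_representable_exists:
  assumes H: "fin_simple_graph H"
  shows "\<exists>d. box_representable H d"
proof -
  let ?P = "all_pairs (verts H)" and ?N = "all_pairs (verts H) - edges H"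
  have "finite ?P"
    by (rule finite_subset[of _ "Pow (verts H)"])
       (use H in \<open>auto simp: all_pairs_def fin_simple_graph_def\<close>)
  then obtain f where f: "bij_betw f {..<card ?N} ?N"
    using ex_bij_betw_nat_finite[of ?N] by (auto simp: atLeast0LessThan)
  define I where "I j = \<lparr> verts = verts H, edges = ?P - {f j} \<rparr>" for j
  have "interval_graph (I j) \<and> verts (I j) = verts H" if "j < card ?N" for j
    using that bij_betwE[OF f] H interval_graph_minus_pair[of "verts H" "f j"]
    by (auto simp: I_def fin_simple_graph_def)
  moreover have "edges H = ?P \<inter> (\<Inter>j<card ?N. edges (I j))"
  proof -
    have "?P \<inter> (\<Inter>j<card ?N. edges (I j)) = ?P - f ` {..<card ?N}"
      by (auto simp: I_def)
    also have "\<dots> = edges H"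
      using H f by (auto simp: bij_betw_def fin_simple_graph_def)
    finally show ?thesis ..
  qed
  ultimately show ?thesis unfolding box_representable_def by blast
qed

end

theory Submission imports Defs begin

text \<open>
  Twins may be given the same interval, so a box representation can be pulled back along every map
  that preserves and reflects adjacency up to collapsing adjacent vertices. Such maps exist in both
  directions: the relation \<open>\<sim>\<close> refines \<open>\<sim>'\<close>, and two vertices related by \<open>\<sim>'\<close> but not by \<open>\<sim>\<close>
  are adjacent. Hence \<open>[v] \<mapsto> [v]'\<close> is such a map, and so is the choice of representatives
  \<open>[v]' \<mapsto> [v]\<close>, which is injective.
\<close>

text \<open>Composing the endpoint functions of an interval graph on \<open>verts K\<close> with
  \<open>f\<close> gives intervals on \<open>verts H\<close>. Vertices with a common image receive
  the same interval, so they become adjacent in every one of the \<open>d\<close> graphs; this is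
  why \<open>adj\<close> demands an edge of \<open>H\<close> between them.\<close>

lemma box_representable_pullback:
  fixes H :: "'a ugraph" and K :: "'b ugraph"
  assumes H: "fin_simple_graph H"
    and f: "f ` verts H \<subseteq> verts K"
    and adj: "\<And>u v. u \<in> verts H \<Longrightarrow> v \<in> verts H \<Longrightarrow> u \<noteq> v \<Longrightarrow>
      {u, v} \<in> edges H \<longleftrightarrow> f u = f v \<or> {f u, f v} \<in> edges K"
    and K: "box_representable K d"
  shows "box_representable H d"
proof -
  obtain I where I: "\<And>j. j < d \<Longrightarrow> interval_graph (I j) \<and> verts (I j) = verts K"
    and E: "edges K = all_pairs (verts K) \<inter> (\<Inter>j<d. edges (I j))"
    using K unfolding box_representable_def by blast
  \<comment> \<open>\<open>J j\<close> is described through adjacency in \<open>I j\<close> rather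
    than through intervals, so endpoint functions need to be picked only for one \<open>j\<close> at
    a time.\<close>
  define J where "J j = \<lparr> verts = verts H, edges = {{u, v} |u v.
      u \<in> verts H \<and> v \<in> verts H \<and> u \<noteq> v \<and> (f u = f v \<or> {f u, f v} \<in> edges (I j))} \<rparr>" for j
  have J_edge: "{u, v} \<in> edges (J j) \<longleftrightarrow> f u = f v \<or> {f u, f v} \<in> edges (I j)"
    if "u \<in> verts H" "v \<in> verts H" "u \<noteq> v" for u v j
    using that by (auto simp: J_def doubleton_eq_iff insert_commute)
  have "interval_graph (J j) \<and> verts (J j) = verts H" if j: "j < d" for j
  proof -
    obtain l r :: "'b \<Rightarrow> real" where lr: "\<And>v. v \<in> verts K \<Longrightarrow> l v \<le> r v"
      and int: "\<And>u v. u \<in> verts K \<Longrightarrow> v \<in> verts K \<Longrightarrow> u \<noteq> v \<Longrightarrow>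
        {u, v} \<in> edges (I j) \<longleftrightarrow> {l u..r u} \<inter> {l v..r v} \<noteq> {}"
      using I[OF j] unfolding interval_graph_def by metis
    have "{u, v} \<in> edges (J j) \<longleftrightarrow> {l (f u)..r (f u)} \<inter> {l (f v)..r (f v)} \<noteq> {}"
      if uv: "u \<in> verts H" "v \<in> verts H" "u \<noteq> v" for u v
    proof (cases "f u = f v")
      case True
      \<comment> \<open>The common interval is nonempty, hence meets itself.\<close>
      then show ?thesis using J_edge[OF uv] lr[of "f v"] f uv by auto
    next
      case False
      then show ?thesis using J_edge[OF uv] int[of "f u" "f v"] f uv by blast
    qed
    moreover have "fin_simple_graph (J j)" "verts (J j) = verts H"
      using H by (auto simp: J_def fin_simple_graph_def all_pairs_def)
    ultimately show ?thesis
      using lr f unfolding interval_graph_def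
      by (intro conjI exI[of _ "l \<circ> f"] exI[of _ "r \<circ> f"]) auto
  qed
  moreover have "edges H = all_pairs (verts H) \<inter> (\<Inter>j<d. edges (J j))"
  proof -
    have "{u, v} \<in> edges H \<longleftrightarrow> {u, v} \<in> (\<Inter>j<d. edges (J j))"
      if uv: "u \<in> verts H" "v \<in> verts H" "u \<noteq> v" for u v
    proof -
      \<comment> \<open>This makes \<open>E\<close> applicable to the image pair. For
        \<open>d = 0\<close> it is all that \<open>E\<close> asks for, since the intersection is
        then universal.\<close>
      have "{f u, f v} \<in> all_pairs (verts K)" if "f u \<noteq> f v"
        using that uv f by (auto simp: all_pairs_def)
      then show ?thesis
        using adj[OF uv] J_edge[OF uv] E by blast
    qed
    then have "e \<in> edges H \<longleftrightarrow> e \<in> (\<Inter>j<d. edges (J j))" if "e \<in> all_pairs (verts H)" for e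
      using that unfolding all_pairs_def by blast
    then show ?thesis
      using H unfolding fin_simple_graph_def by blast
  qed
  ultimately show ?thesis unfolding box_representable_def by blast
qed

text \<open>A section of the projection onto a quotient, used to define maps between the two vertex
  sets of classes.\<close>

lemma some_representative:
  assumes r: "equiv A r" and C: "C \<in> A // r"
  shows "(SOME x. x \<in> C) \<in> A" "r `` {SOME x. x \<in> C} = C"
proof -
  obtain a where a: "a \<in> A" "C = r `` {a}" using C by (rule quotientE)
  have "(SOME x. x \<in> C) \<in> C"
    using in_quotient_imp_non_empty[OF r C] by (simp add: some_in_eq)
  then have ax: "(a, SOME x. x \<in> C) \<in> r" using a(2) by simp
  then show "(SOME x. x \<in> C) \<in> A"
    using r by (meson equiv_class_eq_iff)
  show "r `` {SOME x. x \<in> C} = C"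
    unfolding a(2) using equiv_class_eq[OF r ax, symmetric] by (simp only: a(2))
qed

context
  fixes G :: "'a ugraph"
  assumes G: "fin_simple_graph G"
begin

text \<open>An edge between classes comes from some edge \<open>{a, b}\<close> of \<open>G\<close>.
  As twins have the same neighbours, \<open>b\<close> and then \<open>a\<close> can be exchanged for
  the given representatives.\<close>

lemma reduced_graph_edge_iff:
  assumes V: "u \<in> verts G" "v \<in> verts G"
  shows "{twin_rel G `` {u}, twin_rel G `` {v}} \<in> edges (reduced_graph G) \<longleftrightarrow> {u, v} \<in> edges G"
proof -
  have transfer: "{x, y} \<in> edges G"
    if ab: "{a, b} \<in> edges G" and cls: "twin_rel G `` {x} = twin_rel G `` {a}"
      "twin_rel G `` {y} = twin_rel G `` {b}" and xy: "x \<in> verts G" "y \<in> verts G" for a b x y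
  proof -
    have N: "nbrs G x = nbrs G a" "nbrs G y = nbrs G b"
      using cls xy fin_simple_graph_edgeD[OF G ab] eq_equiv_class_iff[OF equiv_twin_rel]
      by (auto simp: twin_rel_def)
    have "a \<in> nbrs G y"
      using ab fin_simple_graph_edgeD[OF G ab] N by (auto simp: nbrs_def)
    then have "y \<in> nbrs G x" using mem_nbrs_commute xy N by metis
    then show ?thesis by (simp add: nbrs_def insert_commute)
  qed
  show ?thesis
  proof
    assume "{twin_rel G `` {u}, twin_rel G `` {v}} \<in> edges (reduced_graph G)"
    then obtain a b where ab: "{a, b} \<in> edges G"
      and "{twin_rel G `` {u}, twin_rel G `` {v}} = {twin_rel G `` {a}, twin_rel G `` {b}}"
      by (auto simp: reduced_graph_def)
    then show "{u, v} \<in> edges G"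
      using transfer[OF ab, of u v] transfer[OF ab, of v u] V
      by (auto simp: doubleton_eq_iff insert_commute)
  qed (auto simp: reduced_graph_def)
qed

text \<open>The same exchange of endpoints, but now neighbourhoods agree only outside the two
  vertices being exchanged. Distinctness of the classes keeps the other endpoint away from these
  exceptions.\<close>

lemma reduced_graph'_edge_iff:
  assumes V: "u \<in> verts G" "v \<in> verts G" and ne: "twin_rel' G `` {u} \<noteq> twin_rel' G `` {v}"
  shows "{twin_rel' G `` {u}, twin_rel' G `` {v}} \<in> edges (reduced_graph' G) \<longleftrightarrow> {u, v} \<in> edges G"
proof -
  have transfer: "{x, y} \<in> edges G"
    if ab: "{a, b} \<in> edges G" and cls: "twin_rel' G `` {x} = twin_rel' G `` {a}"
      "twin_rel' G `` {y} = twin_rel' G `` {b}" and xy: "x \<in> verts G" "y \<in> verts G"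
      and ne: "twin_rel' G `` {x} \<noteq> twin_rel' G `` {y}" for a b x y
  proof -
    have N: "nbrs G x - {x, a} = nbrs G a - {x, a}" "nbrs G y - {y, b} = nbrs G b - {y, b}"
      using cls xy fin_simple_graph_edgeD[OF G ab] eq_equiv_class_iff[OF equiv_twin_rel']
      by (auto simp: twin_rel'_def)
    \<comment> \<open>Exactly what keeps \<open>a\<close> out of \<open>{y, b}\<close> and
      \<open>y\<close> out of \<open>{x, a}\<close>, the sets deleted in \<open>N\<close>.\<close>
    have distinct: "a \<noteq> y" "a \<noteq> b" "y \<noteq> x" using ne cls by auto
    have "a \<in> nbrs G b"
      using ab fin_simple_graph_edgeD[OF G ab] by (auto simp: nbrs_def)
    then have "a \<in> nbrs G y" using N(2) distinct by blast
    then have "y \<in> nbrs G a" using mem_nbrs_commute xy by metis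
    then have "y \<in> nbrs G x" using N(1) distinct by blast
    then show ?thesis by (simp add: nbrs_def insert_commute)
  qed
  show ?thesis
  proof
    assume "{twin_rel' G `` {u}, twin_rel' G `` {v}} \<in> edges (reduced_graph' G)"
    then obtain a b where ab: "{a, b} \<in> edges G"
      and "{twin_rel' G `` {u}, twin_rel' G `` {v}} = {twin_rel' G `` {a}, twin_rel' G `` {b}}"
      by (auto simp: reduced_graph'_def)
    then show "{u, v} \<in> edges G"
      using transfer[OF ab, of u v] transfer[OF ab, of v u] V ne
      by (auto simp: doubleton_eq_iff insert_commute)
  qed (use ne in \<open>auto simp: reduced_graph'_def\<close>)
qed

lemma twin_class_eq_imp_twin_class'_eq:
  assumes "u \<in> verts G" "v \<in> verts G" "twin_rel G `` {u} = twin_rel G `` {v}"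
  shows "twin_rel' G `` {u} = twin_rel' G `` {v}"
  using assms eq_equiv_class_iff[OF equiv_twin_rel, of u G v]
    eq_equiv_class_iff[OF equiv_twin_rel', of u G v]
  by (auto simp: twin_rel_def twin_rel'_def)

text \<open>For nonadjacent \<open>u\<close> and \<open>v\<close>, neither neighbourhood meets
  \<open>{u, v}\<close>, as there are no loops. Deleting that set then changes nothing, and the two
  relations agree on the pair.\<close>

lemma twin_class'_eq_imp_adjacent:
  assumes V: "u \<in> verts G" "v \<in> verts G"
    and eq': "twin_rel' G `` {u} = twin_rel' G `` {v}"
    and ne: "twin_rel G `` {u} \<noteq> twin_rel G `` {v}"
  shows "{u, v} \<in> edges G"
proof (rule ccontr)
  assume "{u, v} \<notin> edges G"
  then have "u \<notin> nbrs G v" "v \<notin> nbrs G u" "u \<notin> nbrs G u" "v \<notin> nbrs G v"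
    using fin_simple_graph_edgeD(3)[OF G, of u u] fin_simple_graph_edgeD(3)[OF G, of v v]
    by (auto simp: nbrs_def insert_commute)
  moreover have "nbrs G u - {u, v} = nbrs G v - {u, v}"
    using eq' V eq_equiv_class_iff[OF equiv_twin_rel', of u G v] by (auto simp: twin_rel'_def)
  ultimately have "(u, v) \<in> twin_rel G"
    using V by (auto simp: twin_rel_def)
  then show False
    using ne equiv_class_eq[OF equiv_twin_rel] by metis
qed

text \<open>With this for every \<open>d\<close>, both boxicities are minima of the same
  set.\<close>

lemma box_representable_reduced_graph_iff:
  "box_representable (reduced_graph G) d \<longleftrightarrow> box_representable (reduced_graph' G) d"
proof -
  have V: "verts (reduced_graph G) = verts G // twin_rel G"
    "verts (reduced_graph' G) = verts G // twin_rel' G"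
    by (simp_all add: reduced_graph_def reduced_graph'_def)
  note rep = some_representative[OF equiv_twin_rel] and rep' = some_representative[OF equiv_twin_rel']
  show ?thesis
  proof
    let ?f = "\<lambda>C. twin_rel' G `` {SOME x. x \<in> C}"
    assume "box_representable (reduced_graph' G) d"
    then show "box_representable (reduced_graph G) d"
    proof (rule box_representable_pullback[OF fin_simple_reduced_graph[OF G], of ?f, rotated 2])
      show "?f ` verts (reduced_graph G) \<subseteq> verts (reduced_graph' G)"
        using rep(1) by (auto simp: V intro: quotientI)
      fix C D assume CD: "C \<in> verts (reduced_graph G)" "D \<in> verts (reduced_graph G)" "C \<noteq> D"
      define u v where "u = (SOME x. x \<in> C)" and "v = (SOME x. x \<in> D)"
      have uv: "u \<in> verts G" "v \<in> verts G" "twin_rel G `` {u} = C" "twin_rel G `` {v} = D"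
        using CD(1,2) by (simp_all add: u_def v_def V rep)
      \<comment> \<open>Both sides are compared with adjacency of \<open>u\<close> and
        \<open>v\<close> in \<open>G\<close>. If \<open>?f\<close> merges \<open>C\<close> and
        \<open>D\<close>, their representatives are adjacent, so the left side holds as
        well.\<close>
      show "{C, D} \<in> edges (reduced_graph G) \<longleftrightarrow>
          ?f C = ?f D \<or> {?f C, ?f D} \<in> edges (reduced_graph' G)"
        using reduced_graph_edge_iff[OF uv(1,2)] reduced_graph'_edge_iff[OF uv(1,2)]
          twin_class'_eq_imp_adjacent[OF uv(1,2)] uv(3,4) CD(3)
        unfolding u_def[symmetric] v_def[symmetric] by metis
    qed
  next
    let ?g = "\<lambda>C. twin_rel G `` {SOME x. x \<in> C}"
    assume "box_representable (reduced_graph G) d"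
    then show "box_representable (reduced_graph' G) d"
    proof (rule box_representable_pullback[OF fin_simple_reduced_graph'[OF G], of ?g, rotated 2])
      show "?g ` verts (reduced_graph' G) \<subseteq> verts (reduced_graph G)"
        using rep'(1) by (auto simp: V intro: quotientI)
      fix C D assume CD: "C \<in> verts (reduced_graph' G)" "D \<in> verts (reduced_graph' G)" "C \<noteq> D"
      define u v where "u = (SOME x. x \<in> C)" and "v = (SOME x. x \<in> D)"
      have uv: "u \<in> verts G" "v \<in> verts G" "twin_rel' G `` {u} = C" "twin_rel' G `` {v} = D"
        using CD(1,2) by (simp_all add: u_def v_def V rep')
      \<comment> \<open>Here \<open>?g C = ?g D\<close> is impossible, since it would force
        \<open>C = D\<close>; thus \<open>?g\<close> embeds the second quotient as an induced
        subgraph of the first.\<close>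
      show "{C, D} \<in> edges (reduced_graph' G) \<longleftrightarrow>
          ?g C = ?g D \<or> {?g C, ?g D} \<in> edges (reduced_graph G)"
        using reduced_graph_edge_iff[OF uv(1,2)] reduced_graph'_edge_iff[OF uv(1,2)]
          twin_class_eq_imp_twin_class'_eq[OF uv(1,2)] uv(3,4) CD(3)
        unfolding u_def[symmetric] v_def[symmetric] by metis
    qed
  qed
qed

end

theorem theorem35:
  fixes G :: "'a ugraph"
  assumes "fin_simple_graph G"
  shows "boxicity (reduced_graph G) = boxicity (reduced_graph' G)"
  using box_representable_reduced_graph_iff[OF assms] by (simp add: boxicity_def)

end
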